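(* Let $S=I\times\Lambda$ be a rectangular band, where $I$ and $\Lambda$ are nonempty sets, and let $A$ be a right $S$-act with more than two elements. Then $A$ is uniform if and only if it satisfies one of the following conditions: (i) $\mathrm{Ker}(A)=aS$ for every $a\in A$, and for any pair of distinct elements $x,y\in A$ not simultaneously in $\mathrm{Ker}(A)$ there exists $s\in S$ such that $xs\neq ys$; (ii) $Z(A)=\{\theta\}$, for every nonzero element $a\in A$ either $aS=\mathrm{Ker}(A)$ or $aS=\mathrm{Ker}(A)\cup\{\theta\}$, and for any pair of distinct elements $x,y\in A$ not simultaneously in $\mathrm{Ker}(A)$ there exists $s\in S$ such that $xs\neq ys$; (iii) $AS=Z(A)=\{\theta_1,\theta_2\}$ (with $\theta_1\neq\theta_2$), and $A$ is separated.
   Context: The rectangular band $S=I\times\Lambda$ has multiplication $(i,\lambda)(j,\mu)=(i,\mu)$. A right $S$-act is a nonempty set $A$ with a map $A\times S\to A$, $(a,s)\mapsto as$, satisfying $a(st)=(as)t$. A subact is a nonempty subset closed under the action. $Z(A)$ is the set of zero elements of $A$, i.e. of those $\theta\in A$ with $\theta s=\theta$ for all $s\in S$; an element not in $Z(A)$ is called nonzero. A subact is nonzero (nontrivial) if it has more than one element. A subact $B$ of $A$ is large in $A$ if every $S$-homomorphism $g:A\to C$ whose restriction $g|_B$ is a monomorphism (injective) is itself a monomorphism. $A$ is uniform if every nonzero subact of $A$ is large in $A$. $\mathrm{Ker}(A)$ denotes the minimum nontrivial subact of $A$ (the least element, under inclusion, among subacts with more than one element); a condition involving $\mathrm{Ker}(A)$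 includes the assertion that it exists. For $a\in A$, $aS=\{as\mid s\in S\}$, and $AS=\{as\mid a\in A,\ s\in S\}$. A subset $B$ of $A$ is separated if for all $a\neq b$ in $B$ there exists $s\in S\setminus\{1\}$ (where $1$ is the identity element, if any) such that $as\neq bs$. *)

theory Defs
  imports Main
begin

text \<open>A semigroup is given by its carrier \<open>S\<close> and multiplication \<open>m\<close>; a right act over it by its
  carrier \<open>A\<close> and action \<open>act\<close>. Only the values on the carriers matter.\<close>

definition rect_mult :: "'i \<times> 'l \<Rightarrow> 'i \<times> 'l \<Rightarrow> 'i \<times> 'l" where
  "rect_mult s t = (fst s, snd t)"

definition is_identity :: "'s set \<Rightarrow> ('s \<Rightarrow> 's \<Rightarrow> 's) \<Rightarrow> 's \<Rightarrow> bool" where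
  "is_identity S m e \<longleftrightarrow> e \<in> S \<and> (\<forall>s\<in>S. m e s = s \<and> m s e = s)"

definition right_act :: "'s set \<Rightarrow> ('s \<Rightarrow> 's \<Rightarrow> 's) \<Rightarrow> 'a set \<Rightarrow> ('a \<Rightarrow> 's \<Rightarrow> 'a) \<Rightarrow> bool" where
  "right_act S m A act \<longleftrightarrow>
     A \<noteq> {} \<and> (\<forall>a\<in>A. \<forall>s\<in>S. act a s \<in> A) \<and>
     (\<forall>a\<in>A. \<forall>s\<in>S. \<forall>t\<in>S. act a (m s t) = act (act a s) t)"

definition subact :: "'s set \<Rightarrow> 'a set \<Rightarrow> ('a \<Rightarrow> 's \<Rightarrow> 'a) \<Rightarrow> 'a set \<Rightarrow> bool" where
  "subact S A act B \<longleftrightarrow> B \<noteq> {} \<and> B \<subseteq> A \<and> (\<forall>b\<in>B. \<forall>s\<in>S. act b s \<in> B)"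

definition nonzero_subact :: "'s set \<Rightarrow> 'a set \<Rightarrow> ('a \<Rightarrow> 's \<Rightarrow> 'a) \<Rightarrow> 'a set \<Rightarrow> bool" where
  "nonzero_subact S A act B \<longleftrightarrow> subact S A act B \<and> (\<exists>x\<in>B. \<exists>y\<in>B. x \<noteq> y)"

definition zeros :: "'s set \<Rightarrow> 'a set \<Rightarrow> ('a \<Rightarrow> 's \<Rightarrow> 'a) \<Rightarrow> 'a set" where
  "zeros S A act = {\<theta> \<in> A. \<forall>s\<in>S. act \<theta> s = \<theta>}"

definition act_hom ::
    "'s set \<Rightarrow> 'a set \<Rightarrow> ('a \<Rightarrow> 's \<Rightarrow> 'a) \<Rightarrow> 'c set \<Rightarrow> ('c \<Rightarrow> 's \<Rightarrow> 'c) \<Rightarrow> ('a \<Rightarrow> 'c) \<Rightarrow> bool" where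
  "act_hom S A actA C actC g \<longleftrightarrow>
     g ` A \<subseteq> C \<and> (\<forall>a\<in>A. \<forall>s\<in>S. g (actA a s) = actC (g a) s)"

text \<open>The codomains \<open>C\<close> range over acts carried by subsets of the type of \<open>A\<close>, since a definition
  cannot quantify over types. This loses nothing: the image of a homomorphism on \<open>A\<close> can be
  transported to a set of representatives in \<open>A\<close>; see \<open>large_any_codomain\<close> below.\<close>

definition large ::
    "'s set \<Rightarrow> ('s \<Rightarrow> 's \<Rightarrow> 's) \<Rightarrow> 'a set \<Rightarrow> ('a \<Rightarrow> 's \<Rightarrow> 'a) \<Rightarrow> 'a set \<Rightarrow> bool" where
  "large S m A act B \<longleftrightarrow> subact S A act B \<and>
     (\<forall>(C :: 'a set) actC g.
        right_act S m C actC \<and> act_hom S A act C actC g \<and> inj_on g B \<longrightarrow> inj_on g A)"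

lemma large_any_codomain:
  fixes A :: "'a set" and C :: "'c set"
  assumes large: "large S m A act B" and A: "right_act S m A act"
    and C: "right_act S m C actC" and g: "act_hom S A act C actC g" and inj: "inj_on g B"
  shows "inj_on g A"
proof -
  define r where "r x = inv_into A g (g x)" for x
  have r: "r x \<in> A" "g (r x) = g x" if "x \<in> A" for x
    using that unfolding r_def by (auto intro: inv_into_into f_inv_into_f)
  have req: "r x = r y" if "g x = g y" for x y
    using that by (simp add: r_def)
  have cl: "act a s \<in> A" if "a \<in> A" "s \<in> S" for a s
    using A that by (auto simp: right_act_def)
  have gh: "g (act a s) = actC (g a) s" if "a \<in> A" "s \<in> S" for a s
    using g that by (auto simp: act_hom_def)
  have rr: "r (act (r a) s) = r (act a s)" if "a \<in> A" "s \<in> S" for a s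
    by (rule req) (simp add: gh r that)
  have "right_act S m (r ` A) (\<lambda>c s. r (act c s))"
    unfolding right_act_def
  proof (intro conjI ballI)
    show "r ` A \<noteq> {}" using A by (simp add: right_act_def)
  next
    fix c s assume "c \<in> r ` A" "s \<in> S"
    then show "r (act c s) \<in> r ` A" using r(1) cl by blast
  next
    fix c s t assume c: "c \<in> r ` A" and st: "s \<in> S" "t \<in> S"
    then have "c \<in> A" using r(1) by blast
    then show "r (act c (m s t)) = r (act (r (act c s)) t)"
      using A st rr cl by (simp add: right_act_def)
  qed
  moreover have "act_hom S A act (r ` A) (\<lambda>c s. r (act c s)) r"
    by (simp add: act_hom_def rr)
  moreover have BA: "B \<subseteq> A" using large by (simp add: large_def subact_def)
  moreover have "inj_on r B"
    using inj r(2) BA unfolding inj_on_def by (metis subsetD)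
  ultimately have "inj_on r A" using large unfolding large_def by blast
  then show ?thesis using req unfolding inj_on_def by blast
qed

definition uniform_act ::
    "'s set \<Rightarrow> ('s \<Rightarrow> 's \<Rightarrow> 's) \<Rightarrow> 'a set \<Rightarrow> ('a \<Rightarrow> 's \<Rightarrow> 'a) \<Rightarrow> bool" where
  "uniform_act S m A act \<longleftrightarrow> (\<forall>B. nonzero_subact S A act B \<longrightarrow> large S m A act B)"

text \<open>\<open>is_Ker S A act K\<close> says that \<open>Ker(A)\<close> exists and equals \<open>K\<close>; such a \<open>K\<close> is unique.\<close>

definition is_Ker :: "'s set \<Rightarrow> 'a set \<Rightarrow> ('a \<Rightarrow> 's \<Rightarrow> 'a) \<Rightarrow> 'a set \<Rightarrow> bool" where
  "is_Ker S A act K \<longleftrightarrow>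
     nonzero_subact S A act K \<and> (\<forall>B. nonzero_subact S A act B \<longrightarrow> K \<subseteq> B)"

definition orbit :: "'s set \<Rightarrow> ('a \<Rightarrow> 's \<Rightarrow> 'a) \<Rightarrow> 'a \<Rightarrow> 'a set" where
  "orbit S act a = {act a s | s. s \<in> S}"

definition act_image :: "'s set \<Rightarrow> 'a set \<Rightarrow> ('a \<Rightarrow> 's \<Rightarrow> 'a) \<Rightarrow> 'a set" where
  "act_image S A act = {act a s | a s. a \<in> A \<and> s \<in> S}"

definition separated ::
    "'s set \<Rightarrow> ('s \<Rightarrow> 's \<Rightarrow> 's) \<Rightarrow> ('a \<Rightarrow> 's \<Rightarrow> 'a) \<Rightarrow> 'a set \<Rightarrow> bool" where
  "separated S m act B \<longleftrightarrow>
     (\<forall>a\<in>B. \<forall>b\<in>B. a \<noteq> b \<longrightarrow> (\<exists>s\<in>S. \<not> is_identity S m s \<and> act a s \<noteq> act b s))"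

end

theory Submission
  imports Defs
begin

text \<open>
  Uniformity says that a non-trivial congruence on \<open>A\<close> stays non-trivial on every nonzero
  subact. Suppose that \<open>x \<noteq> y\<close> and that each \<open>s\<close> either sends \<open>x\<close> and \<open>y\<close> to the same element or
  maps \<open>{x, y}\<close> into itself. Then gluing \<open>x\<close> to \<open>y\<close> and nothing else is already a congruence, so
  in a uniform act both points lie in every nonzero subact (\<open>uniform_glued_points\<close>). The necessity
  of the three conditions comes from applying this to well chosen pairs.

  Over a rectangular band, \<open>(a (i, \<lambda>)) (j, \<mu>) = a (i, \<mu>)\<close>. So the points of \<open>AS\<close> are partitioned
  into minimal orbits, each element \<open>b\<close> of \<open>AS\<close> lies in its own orbit, and no \<open>s\<close> separates two
  elements of one such orbit. A one-point orbit in \<open>AS\<close> is a zero. Any two points of a larger one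
  can be glued, so in a uniform act it is contained in every nonzero subact, that is, it
  is \<open>Ker(A)\<close>. Hence \<open>AS\<close> consists of zeros and at most one further minimal orbit. Two zeros can also
  be glued, so with two zeros the kernel is \<open>{\<theta>\<^sub>1, \<theta>\<^sub>2}\<close>, which leaves no room for a larger minimal
  orbit: this is (iii). With at most one zero and three points, a larger minimal orbit must exist,
  and the absence or presence of a zero gives (i) or (ii). Finally, a pair that is not contained in
  the kernel and that no \<open>s\<close> separates could be glued, which yields the separation clauses.

  Conversely, each of the three conditions provides a kernel \<open>K\<close> such that \<open>AS\<close> exceeds \<open>K\<close> by at
  most a zero, and such that pairs not contained in \<open>K\<close> are separated. A homomorphism injective
  on \<open>K\<close> remains injective after that zero is added, and a separating \<open>s\<close> moves any collapsed pair
  not contained in \<open>K\<close> to a collapsed pair of distinct points in \<open>AS\<close> (\<open>uniform_if_separated_outside_Ker\<close>).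
\<close>

section \<open>Uniformity of acts over an arbitrary semigroup\<close>

text \<open>The quotient by the congruence that glues \<open>y\<close> to \<open>x\<close> is realised on the transversal
  \<open>A - {y}\<close>; the hypothesis \<open>glue\<close> is exactly what makes this relation a congruence.\<close>

lemma uniform_glued_points:
  assumes act: "right_act S m A act" and unif: "uniform_act S m A act"
    and xy: "x \<in> A" "y \<in> A" "x \<noteq> y"
    and glue: "\<And>s. s \<in> S \<Longrightarrow> act x s = act y s \<or> {act x s, act y s} \<subseteq> {x, y}"
    and B: "nonzero_subact S A act B"
  shows "x \<in> B" "y \<in> B"
proof -
  define g where "g z = (if z = y then x else z)" for z
  have gA: "g z \<in> A - {y}" if "z \<in> A" for z
    using that xy by (auto simp: g_def)
  have g_act: "g (act (g z) s) = g (act z s)" if "s \<in> S" for z s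
    using glue[OF that] by (auto simp: g_def)
  have closed: "act z s \<in> A" if "z \<in> A" "s \<in> S" for z s
    using act that by (auto simp: right_act_def)
  have "right_act S m (A - {y}) (\<lambda>z s. g (act z s))"
    unfolding right_act_def
  proof (intro conjI ballI)
    show "A - {y} \<noteq> {}" using xy by blast
  next
    fix z s assume "z \<in> A - {y}" "s \<in> S"
    then show "g (act z s) \<in> A - {y}" using gA closed by blast
  next
    fix z s t assume "z \<in> A - {y}" "s \<in> S" "t \<in> S"
    then show "g (act z (m s t)) = g (act (g (act z s)) t)"
      using act g_act by (simp add: right_act_def)
  qed
  moreover have "act_hom S A act (A - {y}) (\<lambda>z s. g (act z s)) g"
    using gA g_act by (auto simp: act_hom_def)
  moreover have "\<not> inj_on g A"
    using xy by (auto simp: g_def inj_on_def)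
  moreover have "large S m A act B"
    using unif B by (simp add: uniform_act_def)
  ultimately have "\<not> inj_on g B" unfolding large_def by blast
  then show "x \<in> B" "y \<in> B"
    by (auto simp: g_def inj_on_def split: if_splits)
qed

lemma uniform_separated_outside_Ker:
  assumes "right_act S m A act" "uniform_act S m A act" "is_Ker S A act K"
    and "x \<in> A" "y \<in> A" "x \<noteq> y" "\<not> (x \<in> K \<and> y \<in> K)"
  shows "\<exists>s\<in>S. act x s \<noteq> act y s"
  using uniform_glued_points[OF assms(1,2,4-6), of K] assms(3,7)
  unfolding is_Ker_def by blast

text \<open>If a zero outside the kernel were identified with a kernel element \<open>k\<close>, then so would be all of
  \<open>kS \<subseteq> K\<close>; injectivity on \<open>K\<close> would make \<open>k\<close> a zero, and the subact formed by the two zeros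
  would not contain the kernel.\<close>

lemma inj_on_insert_zero_Ker:
  assumes Ker: "is_Ker S A act K" and zero: "\<theta> \<in> zeros S A act"
    and g: "act_hom S A act C actC g" and inj: "inj_on g K"
  shows "inj_on g (insert \<theta> K)"
proof (cases "\<theta> \<in> K")
  case True
  then show ?thesis using inj by (simp add: insert_absorb)
next
  case False
  have K: "subact S A act K" using Ker by (simp add: is_Ker_def nonzero_subact_def)
  have "g k \<noteq> g \<theta>" if k: "k \<in> K" for k
  proof
    assume eq: "g k = g \<theta>"
    have "act k s = k" if s: "s \<in> S" for s
    proof -
      have kA: "k \<in> A" and ks: "act k s \<in> K" using K k s by (auto simp: subact_def)
      have "g (act k s) = g (act \<theta> s)"
        using g kA zero s eq by (auto simp: act_hom_def zeros_def)
      then have "g (act k s) = g k" using zero s eq by (simp add: zeros_def)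
      then show ?thesis using inj k ks by (auto dest: inj_onD)
    qed
    then have "nonzero_subact S A act {k, \<theta>}"
      using K k zero False by (auto simp: nonzero_subact_def subact_def zeros_def)
    then have "K \<subseteq> {k, \<theta>}" using Ker by (simp add: is_Ker_def)
    then have "K \<subseteq> {k}" using False by blast
    then show False using Ker unfolding is_Ker_def nonzero_subact_def by blast
  qed
  then have "g \<theta> \<notin> g ` (K - {\<theta>})" by (metis DiffD1 imageE)
  then show ?thesis using inj by simp
qed

text \<open>A pair collapsed by \<open>g\<close> but not contained in \<open>K\<close> would be sent by a separating \<open>s\<close> to a collapsed
  pair of distinct elements of \<open>K \<union> {\<theta>}\<close>, where \<open>g\<close> is injective. Allowing \<open>\<theta> \<in> K\<close> covers the case
  \<open>AS \<subseteq> K\<close>.\<close>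

lemma uniform_if_separated_outside_Ker:
  fixes A :: "'a set"
  assumes Ker: "is_Ker S A act K"
    and image: "act_image S A act \<subseteq> insert \<theta> K" and \<theta>: "\<theta> \<in> K \<union> zeros S A act"
    and sep: "\<And>x y. x \<in> A \<Longrightarrow> y \<in> A \<Longrightarrow> x \<noteq> y \<Longrightarrow> \<not> (x \<in> K \<and> y \<in> K) \<Longrightarrow>
        \<exists>s\<in>S. act x s \<noteq> act y s"
  shows "uniform_act S m A act"
  unfolding uniform_act_def
proof (intro allI impI)
  fix B assume B: "nonzero_subact S A act B"
  then have KB: "K \<subseteq> B" using Ker by (simp add: is_Ker_def)
  have "inj_on g A"
    if g: "act_hom S A act C actC g" and inj: "inj_on g B" for C :: "'a set" and actC g
  proof (rule inj_onI, rule ccontr)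
    fix x y assume xy: "x \<in> A" "y \<in> A" "g x = g y" "x \<noteq> y"
    have injK: "inj_on g K" using inj KB by (rule inj_on_subset)
    have inj': "inj_on g (insert \<theta> K)"
    proof (cases "\<theta> \<in> K")
      case True
      then show ?thesis using injK by (simp add: insert_absorb)
    next
      case False
      then show ?thesis using inj_on_insert_zero_Ker[OF Ker _ g injK] \<theta> by blast
    qed
    have "\<not> (x \<in> K \<and> y \<in> K)" using injK xy by (auto dest: inj_onD)
    then obtain s where s: "s \<in> S" "act x s \<noteq> act y s" using sep xy by blast
    have "act x s \<in> insert \<theta> K" "act y s \<in> insert \<theta> K"
      using image xy s by (auto simp: act_image_def)
    moreover have "g (act x s) = g (act y s)"
      using g xy s by (simp add: act_hom_def)
    ultimately show False using inj_onD[OF inj'] s(2) by metis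
  qed
  then show "large S m A act B"
    using B unfolding large_def nonzero_subact_def by blast
qed

section \<open>Acts over a rectangular band\<close>

locale rectangular_band_act =
  fixes I :: "'i set" and L :: "'l set"
    and A :: "'a set" and act :: "'a \<Rightarrow> 'i \<times> 'l \<Rightarrow> 'a"
  assumes I_nonempty: "I \<noteq> {}" and L_nonempty: "L \<noteq> {}"
    and right_act: "right_act (I \<times> L) rect_mult A act"
begin

abbreviation S :: "('i \<times> 'l) set" where "S \<equiv> I \<times> L"

lemma act_closed: "a \<in> A \<Longrightarrow> s \<in> S \<Longrightarrow> act a s \<in> A"
  using right_act unfolding right_act_def by blast

lemma act_act: "a \<in> A \<Longrightarrow> s \<in> S \<Longrightarrow> t \<in> S \<Longrightarrow> act (act a s) t = act a (fst s, snd t)"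
  using right_act unfolding right_act_def rect_mult_def by metis

lemma image_subset: "act_image S A act \<subseteq> A"
  using act_closed by (auto simp: act_image_def)

lemma act_in_image: "a \<in> A \<Longrightarrow> s \<in> S \<Longrightarrow> act a s \<in> act_image S A act"
  by (auto simp: act_image_def)

lemma orbit_subact: "a \<in> A \<Longrightarrow> subact S A act (orbit S act a)"
proof -
  assume a: "a \<in> A"
  have "act (act a s) t \<in> orbit S act a" if "s \<in> S" "t \<in> S" for s t
  proof -
    have "(fst s, snd t) \<in> S" using that by auto
    then show ?thesis using act_act[OF a that] unfolding orbit_def by blast
  qed
  moreover have "orbit S act a \<subseteq> A" using a act_closed by (auto simp: orbit_def)
  moreover have "orbit S act a \<noteq> {}" using I_nonempty L_nonempty by (auto simp: orbit_def)
  ultimately show ?thesis by (auto simp: subact_def orbit_def)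
qed

text \<open>With \<open>b = a (i, \<lambda>)\<close>, the first coordinate of anything acting on \<open>b\<close> is overwritten by \<open>i\<close>, and
  of two consecutive second coordinates only the last one survives.\<close>

lemma image_act_act:
  assumes "b \<in> act_image S A act" "s \<in> S" "t \<in> S"
  shows "act (act b s) t = act b t"
proof -
  from assms(1) obtain a r where a: "a \<in> A" "r \<in> S" "b = act a r"
    by (auto simp: act_image_def)
  have rs: "(fst r, snd s) \<in> S" using a assms by auto
  show ?thesis using a assms rs by (simp add: act_act)
qed

lemma image_in_own_orbit:
  assumes "b \<in> act_image S A act"
  shows "b \<in> orbit S act b"
proof -
  from assms obtain a r where a: "a \<in> A" "r \<in> S" "b = act a r"
    by (auto simp: act_image_def)
  then have "act b r = b" by (simp add: act_act)
  then show ?thesis using a unfolding orbit_def by force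
qed

lemma zeros_subset_image: "zeros S A act \<subseteq> act_image S A act"
proof
  fix z assume "z \<in> zeros S A act"
  moreover obtain s where "s \<in> S" using I_nonempty L_nonempty by auto
  ultimately show "z \<in> act_image S A act"
    using act_in_image[of z s] by (auto simp: zeros_def)
qed

text \<open>An element of \<open>AS\<close> acts like every other element of its orbit; a zero in the orbit would
  therefore be the whole orbit.\<close>

lemma zero_notin_image_orbit:
  assumes b: "b \<in> act_image S A act" "b \<notin> zeros S A act"
  shows "orbit S act b \<inter> zeros S A act = {}"
proof -
  have False if z: "z \<in> orbit S act b" "z \<in> zeros S A act" for z
  proof -
    obtain t where t: "t \<in> S" "z = act b t" using z(1) by (auto simp: orbit_def)
    have "act b s = z" if "s \<in> S" for s
      using image_act_act[OF b(1) t(1) that] t(2) z(2) that unfolding zeros_def by force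
    then have "orbit S act b \<subseteq> {z}" by (auto simp: orbit_def)
    then show False using image_in_own_orbit[OF b(1)] z b(2) by blast
  qed
  then show ?thesis by blast
qed

section \<open>The kernel of a uniform act\<close>

text \<open>No \<open>s\<close> separates \<open>b\<close> from another point of its orbit, so such a pair can be glued and is contained
  in every nonzero subact; the orbit has at least two points because \<open>b\<close> is not a zero.\<close>

lemma uniform_image_orbit_is_Ker:
  assumes unif: "uniform_act S rect_mult A act"
    and b: "b \<in> act_image S A act" "b \<notin> zeros S A act"
  shows "is_Ker S A act (orbit S act b)"
proof -
  have bA: "b \<in> A" using b image_subset by blast
  obtain s where s: "s \<in> S" "act b s \<noteq> b" using b bA by (auto simp: zeros_def)
  have own: "b \<in> orbit S act b" using image_in_own_orbit[OF b(1)] .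
  have glued: "b \<in> B \<and> c \<in> B"
    if B: "nonzero_subact S A act B" and c: "c \<in> orbit S act b" "c \<noteq> b" for B c
  proof -
    obtain r where r: "r \<in> S" "c = act b r" using c by (auto simp: orbit_def)
    have "act b t = act c t" if "t \<in> S" for t
      using image_act_act[OF b(1) r(1) that] r(2) by simp
    moreover have "c \<in> A" using r act_closed[OF bA] by simp
    ultimately show ?thesis
      using uniform_glued_points[OF right_act unif bA _ _ _ B, of c] c by blast
  qed
  have sb: "act b s \<in> orbit S act b" using s by (auto simp: orbit_def)
  have "nonzero_subact S A act (orbit S act b)"
    using orbit_subact[OF bA] own sb s unfolding nonzero_subact_def by blast
  then show ?thesis
    using glued sb s unfolding is_Ker_def by blast
qed

text \<open>If all of \<open>AS\<close> consisted of zeros, then \<open>AS = {\<theta>}\<close>: every pair could be glued, and the nonzero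
  subact \<open>{a, \<theta>}\<close> would contain any third point \<open>c\<close>.\<close>

lemma uniform_nonzero_in_image:
  assumes unif: "uniform_act S rect_mult A act"
    and one_zero: "\<And>z z'. z \<in> zeros S A act \<Longrightarrow> z' \<in> zeros S A act \<Longrightarrow> z = z'"
    and three: "\<exists>x\<in>A. \<exists>y\<in>A. \<exists>z\<in>A. x \<noteq> y \<and> x \<noteq> z \<and> y \<noteq> z"
  obtains b where "b \<in> act_image S A act" "b \<notin> zeros S A act"
proof -
  have False if sub: "act_image S A act \<subseteq> zeros S A act"
  proof -
    obtain x s where xs: "x \<in> A" "s \<in> S" using three I_nonempty L_nonempty by auto
    define \<theta> where "\<theta> = act x s"
    have \<theta>: "\<theta> \<in> zeros S A act" using act_in_image xs sub by (auto simp: \<theta>_def)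
    then have \<theta>A: "\<theta> \<in> A" by (simp add: zeros_def)
    have const: "act z t = \<theta>" if "z \<in> A" "t \<in> S" for z t
      using one_zero[OF _ \<theta>] act_in_image[OF that] sub by blast
    obtain a c where ac: "a \<in> A" "c \<in> A" "a \<noteq> \<theta>" "c \<noteq> \<theta>" "a \<noteq> c"
      using three by metis
    have "nonzero_subact S A act {a, \<theta>}"
      using ac \<theta>A const by (auto simp: nonzero_subact_def subact_def)
    moreover have "act c t = act \<theta> t" if "t \<in> S" for t
      using const ac(2) \<theta>A that by simp
    ultimately have "c \<in> {a, \<theta>}"
      using uniform_glued_points(1)[OF right_act unif ac(2) \<theta>A ac(4)] by blast
    then show False using ac by blast
  qed
  then show thesis using that by blast
qed

lemma uniform_image_subset:
  assumes unif: "uniform_act S rect_mult A act" and Ker: "is_Ker S A act K"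
  shows "act_image S A act \<subseteq> K \<union> zeros S A act"
proof
  fix c assume c: "c \<in> act_image S A act"
  have "c \<in> K" if "c \<notin> zeros S A act"
  proof -
    have "is_Ker S A act (orbit S act c)"
      using uniform_image_orbit_is_Ker[OF unif c that] .
    then have "orbit S act c = K" using Ker unfolding is_Ker_def by blast
    then show ?thesis using image_in_own_orbit[OF c] by simp
  qed
  then show "c \<in> K \<union> zeros S A act" by blast
qed

text \<open>Otherwise \<open>aS\<close> is a single zero \<open>\<theta>\<close>, and \<open>{a, \<theta>}\<close> is a nonzero subact; a kernel inside it
  that avoids \<open>\<theta>\<close> would have at most one point.\<close>

lemma Ker_subset_nonzero_orbit:
  assumes Ker: "is_Ker S A act K" and a: "a \<in> A" "a \<notin> zeros S A act"
    and zero_free: "K \<inter> zeros S A act = {}"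
  shows "K \<subseteq> orbit S act a"
proof (rule ccontr)
  assume not_sub: "\<not> K \<subseteq> orbit S act a"
  have sub: "subact S A act (orbit S act a)" using orbit_subact[OF a(1)] .
  obtain \<theta> where \<theta>: "\<theta> \<in> orbit S act a" "\<theta> \<in> A" using sub unfolding subact_def by blast
  have "\<not> nonzero_subact S A act (orbit S act a)" using Ker not_sub unfolding is_Ker_def by blast
  then have single: "u = \<theta>" if "u \<in> orbit S act a" for u
    using sub \<theta> that unfolding nonzero_subact_def by blast
  have "act \<theta> s = \<theta>" if "s \<in> S" for s
    using single sub \<theta> that unfolding subact_def by blast
  then have \<theta>Z: "\<theta> \<in> zeros S A act" using \<theta> unfolding zeros_def by blast
  have "act a s = \<theta>" if "s \<in> S" for s
    using single that unfolding orbit_def by blast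
  then have "nonzero_subact S A act {a, \<theta>}"
    using a \<theta>Z by (auto simp: nonzero_subact_def subact_def zeros_def)
  then have "K \<subseteq> {a, \<theta>}" using Ker by (simp add: is_Ker_def)
  then have "K \<subseteq> {a}" using zero_free \<theta>Z by blast
  then show False using Ker unfolding is_Ker_def nonzero_subact_def by blast
qed

text \<open>Two zeros can be glued, so they lie in every nonzero subact. A non-zero element of \<open>AS\<close> would
  have an orbit that is a nonzero subact free of zeros.\<close>

lemma uniform_two_zeros:
  assumes unif: "uniform_act S rect_mult A act"
    and z: "z \<in> zeros S A act" "z' \<in> zeros S A act" "z \<noteq> z'"
  shows "is_Ker S A act {z, z'}" "act_image S A act = {z, z'}" "zeros S A act = {z, z'}"
proof -
  have glued: "u \<in> B" "v \<in> B"
    if uv: "u \<in> zeros S A act" "v \<in> zeros S A act" "u \<noteq> v"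
      and B: "nonzero_subact S A act B" for u v B
    using uniform_glued_points[OF right_act unif _ _ uv(3) _ B] uv by (auto simp: zeros_def)
  have pair: "nonzero_subact S A act {z, z'}"
    using z by (auto simp: nonzero_subact_def subact_def zeros_def)
  show "is_Ker S A act {z, z'}"
    using pair glued[OF z] by (auto simp: is_Ker_def)
  have zeros: "zeros S A act \<subseteq> {z, z'}"
    using glued(1)[OF _ z(1) _ pair] by blast
  then show "zeros S A act = {z, z'}" using z by blast
  have "b \<in> zeros S A act" if b: "b \<in> act_image S A act" for b
  proof (rule ccontr)
    assume nz: "b \<notin> zeros S A act"
    have "nonzero_subact S A act (orbit S act b)"
      using uniform_image_orbit_is_Ker[OF unif b nz] by (simp add: is_Ker_def)
    then have "z \<in> orbit S act b" using glued[OF z] by blast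
    then show False using zero_notin_image_orbit[OF b nz] z by blast
  qed
  then show "act_image S A act = {z, z'}"
    using zeros_subset_image zeros z by blast
qed

text \<open>An identity forces \<open>S\<close> to be a single point \<open>e\<close>, and then \<open>a\<close> and \<open>a e\<close> are not separated
  although they differ for every non-zero \<open>a\<close>.\<close>

lemma no_identity_if_separated:
  assumes a: "a \<in> A" "a \<notin> zeros S A act"
    and sep: "\<And>x y. x \<in> A \<Longrightarrow> y \<in> A \<Longrightarrow> x \<noteq> y \<Longrightarrow> \<exists>s\<in>S. act x s \<noteq> act y s"
  shows "\<not> is_identity S rect_mult e"
proof
  assume e: "is_identity S rect_mult e"
  then have eS: "e \<in> S" by (simp add: is_identity_def)
  have single: "s = e" if "s \<in> S" for s
  proof (rule prod_eqI)
    from e that have *: "rect_mult e s = s" "rect_mult s e = s" by (auto simp: is_identity_def)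
    show "fst s = fst e" using arg_cong[OF *(1), of fst] by (simp add: rect_mult_def)
    show "snd s = snd e" using arg_cong[OF *(2), of snd] by (simp add: rect_mult_def)
  qed
  have "a \<noteq> act a e"
    using a single by (auto simp: zeros_def)
  then obtain s where s: "s \<in> S" "act a s \<noteq> act (act a e) s"
    using sep[OF a(1) act_closed[OF a(1) eS]] by blast
  then show False using single[OF s(1)] act_act[OF a(1) eS eS] by simp
qed

end

section \<open>Characterisation of uniform acts\<close>

theorem theorem3p10:
  fixes I :: "'i set" and L :: "'l set"
    and A :: "'a set" and act :: "'a \<Rightarrow> 'i \<times> 'l \<Rightarrow> 'a"
  assumes "I \<noteq> {}" and "L \<noteq> {}"
    and "right_act (I \<times> L) rect_mult A act"
    and "\<exists>x\<in>A. \<exists>y\<in>A. \<exists>z\<in>A. x \<noteq> y \<and> x \<noteq> z \<and> y \<noteq> z"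
  shows "uniform_act (I \<times> L) rect_mult A act \<longleftrightarrow>
    (\<exists>K. is_Ker (I \<times> L) A act K \<and>
         (\<forall>a\<in>A. K = orbit (I \<times> L) act a) \<and>
         (\<forall>x\<in>A. \<forall>y\<in>A. x \<noteq> y \<and> \<not> (x \<in> K \<and> y \<in> K) \<longrightarrow> (\<exists>s\<in>I \<times> L. act x s \<noteq> act y s)))
  \<or> (\<exists>\<theta> K. zeros (I \<times> L) A act = {\<theta>} \<and>
         is_Ker (I \<times> L) A act K \<and>
         (\<forall>a\<in>A. a \<notin> zeros (I \<times> L) A act \<longrightarrow>
            orbit (I \<times> L) act a = K \<or> orbit (I \<times> L) act a = K \<union> {\<theta>}) \<and>
         (\<forall>x\<in>A. \<forall>y\<in>A. x \<noteq> y \<and> \<not> (x \<in> K \<and> y \<in> K) \<longrightarrow> (\<exists>s\<in>I \<times> L. act x s \<noteq> act y s)))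
  \<or> (\<exists>\<theta>\<^sub>1 \<theta>\<^sub>2. \<theta>\<^sub>1 \<noteq> \<theta>\<^sub>2 \<and>
         act_image (I \<times> L) A act = zeros (I \<times> L) A act \<and>
         zeros (I \<times> L) A act = {\<theta>\<^sub>1, \<theta>\<^sub>2} \<and>
         separated (I \<times> L) rect_mult act A)"
proof -
  interpret rectangular_band_act I L A act
    using assms by unfold_locales
  let ?Z = "zeros S A act"
  let ?sep = "\<lambda>K. \<forall>x\<in>A. \<forall>y\<in>A. x \<noteq> y \<and> \<not> (x \<in> K \<and> y \<in> K) \<longrightarrow> (\<exists>s\<in>S. act x s \<noteq> act y s)"
  let ?i = "\<exists>K. is_Ker S A act K \<and> (\<forall>a\<in>A. K = orbit S act a) \<and> ?sep K"
  let ?ii = "\<exists>\<theta> K. ?Z = {\<theta>} \<and> is_Ker S A act K \<and>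
      (\<forall>a\<in>A. a \<notin> ?Z \<longrightarrow> orbit S act a = K \<or> orbit S act a = K \<union> {\<theta>}) \<and> ?sep K"
  let ?iii = "\<exists>\<theta>\<^sub>1 \<theta>\<^sub>2. \<theta>\<^sub>1 \<noteq> \<theta>\<^sub>2 \<and> act_image S A act = ?Z \<and> ?Z = {\<theta>\<^sub>1, \<theta>\<^sub>2} \<and>
      separated S rect_mult act A"
  have "?i \<or> ?ii \<or> ?iii" if unif: "uniform_act S rect_mult A act"
  proof (cases "\<exists>z\<in>?Z. \<exists>z'\<in>?Z. z \<noteq> z'")
    case True
    then obtain z z' where z: "z \<in> ?Z" "z' \<in> ?Z" "z \<noteq> z'" by blast
    note two = uniform_two_zeros[OF unif z]
    note sep = uniform_separated_outside_Ker[OF right_act unif two(1)]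
    \<comment> \<open>Two distinct zeros are separated by every \<open>s\<close>, so the clause extends to all pairs.\<close>
    have sep_all: "\<exists>s\<in>S. act x s \<noteq> act y s" if "x \<in> A" "y \<in> A" "x \<noteq> y" for x y
    proof (cases "x \<in> {z, z'} \<and> y \<in> {z, z'}")
      case True
      then have "x \<in> ?Z" "y \<in> ?Z" using z by auto
      then show ?thesis using that(3) assms(1,2) by (auto simp: zeros_def)
    next
      case False
      then show ?thesis using sep[OF that] by blast
    qed
    obtain a where a: "a \<in> A" "a \<notin> ?Z" using assms(4) two(3) by (metis insertE singletonD)
    have "\<not> is_identity S rect_mult s" for s
      using no_identity_if_separated[OF a] sep_all by blast
    then have "separated S rect_mult act A" using sep_all by (simp add: separated_def)
    then show ?thesis using two z by metis
  next
    case False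
    then obtain b where b: "b \<in> act_image S A act" "b \<notin> ?Z"
      using uniform_nonzero_in_image[OF unif _ assms(4)] by blast
    define K where "K = orbit S act b"
    have Ker: "is_Ker S A act K"
      using uniform_image_orbit_is_Ker[OF unif b] by (simp add: K_def)
    have sep: "?sep K"
      using uniform_separated_outside_Ker[OF right_act unif Ker] by blast
    have image: "orbit S act a \<subseteq> K \<union> ?Z" if "a \<in> A" for a
      using uniform_image_subset[OF unif Ker] act_in_image[OF that] by (auto simp: orbit_def)
    have K_orbit: "K \<subseteq> orbit S act a" if "a \<in> A" "a \<notin> ?Z" for a
      using Ker_subset_nonzero_orbit[OF Ker that] zero_notin_image_orbit[OF b]
      by (auto simp: K_def)
    show ?thesis
    proof (cases "?Z = {}")
      case True
      then have "\<forall>a\<in>A. K = orbit S act a" using image K_orbit by blast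
      then show ?thesis using Ker sep by blast
    next
      case nonempty: False
      then obtain \<theta> where Z: "?Z = {\<theta>}" using False by blast
      have "orbit S act a = K \<or> orbit S act a = K \<union> {\<theta>}" if "a \<in> A" "a \<notin> ?Z" for a
      proof -
        have "orbit S act a \<subseteq> K \<union> {\<theta>}" using image[OF that(1)] unfolding Z .
        moreover have "K \<subseteq> orbit S act a" using K_orbit[OF that] .
        ultimately show ?thesis by blast
      qed
      then have "?Z = {\<theta>} \<and> is_Ker S A act K \<and>
          (\<forall>a\<in>A. a \<notin> ?Z \<longrightarrow> orbit S act a = K \<or> orbit S act a = K \<union> {\<theta>}) \<and> ?sep K"
        using Z Ker sep by simp
      then show ?thesis by (intro disjI2 disjI1 exI)
    qed
  qed
  moreover have "uniform_act S rect_mult A act" if ?i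
  proof -
    from that obtain K where K: "is_Ker S A act K" "\<forall>a\<in>A. K = orbit S act a" "?sep K" by blast
    then obtain k where "k \<in> K" by (auto simp: is_Ker_def nonzero_subact_def)
    moreover have "act_image S A act \<subseteq> insert k K"
      using K(2) by (auto simp: act_image_def orbit_def)
    ultimately show ?thesis
      using uniform_if_separated_outside_Ker[OF K(1)] K(3) by blast
  qed
  moreover have "uniform_act S rect_mult A act" if ?ii
  proof -
    from that obtain \<theta> K where Z: "?Z = {\<theta>}" and Ker: "is_Ker S A act K"
      and orb: "\<forall>a\<in>A. a \<notin> ?Z \<longrightarrow> orbit S act a = K \<or> orbit S act a = K \<union> {\<theta>}"
      and sep: "?sep K" by blast
    have "act a s \<in> insert \<theta> K" if "a \<in> A" "s \<in> S" for a s
    proof (cases "a \<in> ?Z")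
      case True
      then have "act a s = \<theta>" using Z that by (auto simp: zeros_def)
      then show ?thesis by simp
    next
      case False
      have "act a s \<in> orbit S act a" using that by (auto simp: orbit_def)
      then show ?thesis using orb that(1) False by blast
    qed
    then have "act_image S A act \<subseteq> insert \<theta> K" by (auto simp: act_image_def)
    then show ?thesis
      using uniform_if_separated_outside_Ker[OF Ker] Z sep by blast
  qed
  moreover have "uniform_act S rect_mult A act" if ?iii
  proof -
    from that obtain z z' where z: "z \<noteq> z'" "act_image S A act = ?Z" "?Z = {z, z'}"
      and separated: "separated S rect_mult act A" by blast
    have sep: "\<exists>s\<in>S. act x s \<noteq> act y s" if "x \<in> A" "y \<in> A" "x \<noteq> y" for x y
      using separated that unfolding separated_def by blast
    have zZ: "z \<in> ?Z" "z' \<in> ?Z" using z(3) by auto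
    \<comment> \<open>A separating \<open>s\<close> sends two distinct points of a subact to the two zeros.\<close>
    have least: "{z, z'} \<subseteq> B" if B: "nonzero_subact S A act B" for B
    proof -
      obtain x y where xy: "x \<in> B" "y \<in> B" "x \<noteq> y" using B by (auto simp: nonzero_subact_def)
      have BA: "B \<subseteq> A" and closed: "\<And>u s. u \<in> B \<Longrightarrow> s \<in> S \<Longrightarrow> act u s \<in> B"
        using B unfolding nonzero_subact_def subact_def by blast+
      obtain s where s: "s \<in> S" "act x s \<noteq> act y s" using sep xy BA by blast
      have "act x s \<in> {z, z'}" "act y s \<in> {z, z'}"
        using act_in_image s xy BA z(2,3) by blast+
      then show ?thesis using s closed xy by (metis empty_iff insert_iff subsetI)
    qed
    have "nonzero_subact S A act {z, z'}"
      using zZ z(1) by (auto simp: nonzero_subact_def subact_def zeros_def)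
    then have Ker: "is_Ker S A act {z, z'}" using least by (simp add: is_Ker_def)
    show ?thesis
      using uniform_if_separated_outside_Ker[OF Ker, of z] z(2,3) sep by blast
  qed
  ultimately show ?thesis by blast
qed

end
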